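(* Let $K$ be a field, $I$ a set, and $E\subset K^I$ a linear subspace containing the constant functions. Suppose that $E$ is stable with respect to some operation $f:K^n\to K$ which is not additively affine. Then $E$ is topology-inducing on $I$, i.e. the union of any two $E$-closed subsets of $I$ is $E$-closed (so that the $E$-closed sets are the closed sets of a topology on $I$).
   Context: $K^I$ is the $K$-vector space of all functions $I\to K$. An operation is any function $f:K^n\to K$ ($n\ge 1$). It is additively affine if it is the sum of a constant and a homomorphism of additive groups $K^n\to K$. $E$ is stable with respect to $f$ if for all $\xi_1,\ldots,\xi_n\in E$ the function $t\mapsto f(\xi_1(t),\ldots,\xi_n(t))$ is in $E$. A subset $S\subset I$ is $E$-closed if for every $t\in I\setminus S$ there is a $\xi\in E$ vanishing on $S$ with $\xi(t)\neq 0$. (For $E$ containing the constants, $\emptyset$ and $I$ are $E$-closed, and any intersection of $E$-closed sets is $E$-closed.) A linear subspace $E$ containing the constants is topology-inducing if the union of any two $E$-closed subsets of $I$ is $E$-closed. *)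

theory Defs
  imports "HOL-Analysis.Finite_Cartesian_Product" "HOL-Analysis.Abstract_Topology"
begin

text \<open>
  The space \<open>K\<^sup>I\<close> is represented by the extensional functions \<open>I \<rightarrow>\<^sub>E UNIV\<close>, so that the set \<open>I\<close>
  may be empty and elements of \<open>K\<^sup>I\<close> are determined by their values on \<open>I\<close>. The scalar field is
  the type \<open>'k\<close>, and \<open>K\<^sup>n\<close> is the type \<open>'k ^ 'n\<close>, where \<open>n = CARD('n) \<ge> 1\<close>.
\<close>

definition linear_subspace :: "'i set \<Rightarrow> ('i \<Rightarrow> 'k::field) set \<Rightarrow> bool" where
  "linear_subspace I E \<longleftrightarrow>
     E \<subseteq> (I \<rightarrow>\<^sub>E UNIV) \<and>
     (\<lambda>t\<in>I. 0) \<in> E \<and>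
     (\<forall>\<xi>\<in>E. \<forall>\<eta>\<in>E. (\<lambda>t\<in>I. \<xi> t + \<eta> t) \<in> E) \<and>
     (\<forall>c. \<forall>\<xi>\<in>E. (\<lambda>t\<in>I. c * \<xi> t) \<in> E)"

definition contains_constants :: "'i set \<Rightarrow> ('i \<Rightarrow> 'k::field) set \<Rightarrow> bool" where
  "contains_constants I E \<longleftrightarrow> (\<forall>c. (\<lambda>t\<in>I. c) \<in> E)"

definition additively_affine :: "('k::field ^ 'n::finite \<Rightarrow> 'k) \<Rightarrow> bool" where
  "additively_affine f \<longleftrightarrow> (\<exists>c h. Modules.additive h \<and> f = (\<lambda>x. c + h x))"

definition stable_wrt ::
  "'i set \<Rightarrow> ('i \<Rightarrow> 'k::field) set \<Rightarrow> ('k ^ 'n::finite \<Rightarrow> 'k) \<Rightarrow> bool" where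
  "stable_wrt I E f \<longleftrightarrow>
     (\<forall>\<xi> :: 'n \<Rightarrow> 'i \<Rightarrow> 'k. (\<forall>j. \<xi> j \<in> E) \<longrightarrow> (\<lambda>t\<in>I. f (\<chi> j. \<xi> j t)) \<in> E)"

definition E_closed :: "'i set \<Rightarrow> ('i \<Rightarrow> 'k::field) set \<Rightarrow> 'i set \<Rightarrow> bool" where
  "E_closed I E S \<longleftrightarrow>
     S \<subseteq> I \<and> (\<forall>t\<in>I - S. \<exists>\<xi>\<in>E. (\<forall>s\<in>S. \<xi> s = 0) \<and> \<xi> t \<noteq> 0)"

definition topology_inducing :: "'i set \<Rightarrow> ('i \<Rightarrow> 'k::field) set \<Rightarrow> bool" where
  "topology_inducing I E \<longleftrightarrow>
     linear_subspace I E \<and> contains_constants I E \<and>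
     (\<forall>S T. E_closed I E S \<longrightarrow> E_closed I E T \<longrightarrow> E_closed I E (S \<union> T))"

end

theory Submission
  imports Defs
begin

text \<open>
  If \<open>f\<close> is not additively affine, its second difference
  \<open>f (a + b) - f a - f b + f 0\<close> is nonzero for some \<open>a\<close>, \<open>b\<close>. Given \<open>\<xi>\<close> vanishing on \<open>S\<close> and \<open>\<eta>\<close>
  vanishing on \<open>T\<close>, both with value \<open>1\<close> at \<open>t\<close>, the second difference of \<open>f\<close> at \<open>\<xi> a\<close>, \<open>\<eta> b\<close>
  lies in \<open>E\<close>, vanishes wherever \<open>\<xi>\<close> or \<open>\<eta>\<close> does, and is nonzero at \<open>t\<close>.
\<close>

text \<open>If every second difference vanished, rearranging would make \<open>f x - f 0\<close>
  additive in \<open>x\<close>, so \<open>f\<close> would be the constant \<open>f 0\<close> plus a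
  homomorphism.\<close>

lemma not_additively_affine_imp_second_difference:
  fixes f :: "'k::field ^ 'n::finite \<Rightarrow> 'k"
  assumes "\<not> additively_affine f"
  obtains a b where "f (a + b) - f a - f b + f 0 \<noteq> 0"
proof -
  have "\<exists>a b. f (a + b) - f a - f b + f 0 \<noteq> 0"
  proof (rule ccontr)
    assume "\<not> ?thesis"
    then have second_difference: "f (a + b) - f a - f b + f 0 = 0" for a b
      by blast
    have "f (a + b) - f 0 = (f a - f 0) + (f b - f 0)" for a b
      using second_difference[of a b] by (simp add: algebra_simps)
    then have "Modules.additive (\<lambda>x. f x - f 0)"
      by (rule additive.intro)
    moreover have "f = (\<lambda>x. f 0 + (f x - f 0))"
      by simp
    ultimately show False
      using assms unfolding additively_affine_def by blast
  qed
  then show thesis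
    using that by blast
qed

lemma linear_subspace_add:
  assumes "linear_subspace I E" "\<xi> \<in> E" "\<eta> \<in> E"
  shows "(\<lambda>t\<in>I. \<xi> t + \<eta> t) \<in> E"
  using assms by (auto simp: linear_subspace_def)

lemma linear_subspace_scale:
  assumes "linear_subspace I E" "\<xi> \<in> E"
  shows "(\<lambda>t\<in>I. c * \<xi> t) \<in> E"
  using assms by (auto simp: linear_subspace_def)

lemma linear_subspace_diff:
  assumes "linear_subspace I E" "\<xi> \<in> E" "\<eta> \<in> E"
  shows "(\<lambda>t\<in>I. \<xi> t - \<eta> t) \<in> E"
proof -
  have "(\<lambda>t\<in>I. \<xi> t + (\<lambda>t\<in>I. - 1 * \<eta> t) t) \<in> E"
    using assms by (intro linear_subspace_add linear_subspace_scale)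
  then show ?thesis
    by (simp cong: restrict_cong)
qed

text \<open>Scaling by \<open>inverse (\<xi> t)\<close> normalizes the value at \<open>t\<close> to
  1, so that one pair \<open>a\<close>, \<open>b\<close> chosen from \<open>f\<close> alone serves
  for every \<open>t\<close>.\<close>

lemma E_closed_separation:
  assumes "linear_subspace I E" "E_closed I E S" "t \<in> I - S"
  obtains \<xi> where "\<xi> \<in> E" "\<forall>s\<in>S. \<xi> s = 0" "\<xi> t = 1"
proof -
  obtain \<xi> where \<xi>: "\<xi> \<in> E" "\<forall>s\<in>S. \<xi> s = 0" "\<xi> t \<noteq> 0"
    using assms(2,3) unfolding E_closed_def by blast
  have "S \<subseteq> I"
    using assms by (simp add: E_closed_def)
  with \<xi> assms(3) show thesis
    by (intro that[of "\<lambda>s\<in>I. inverse (\<xi> t) * \<xi> s"])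
       (auto intro: linear_subspace_scale[OF assms(1)])
qed

lemma stable_wrt_combination:
  fixes f :: "'k::field ^ 'n::finite \<Rightarrow> 'k"
  assumes "linear_subspace I E" "stable_wrt I E f" "\<xi> \<in> E" "\<eta> \<in> E"
  shows "(\<lambda>t\<in>I. f (\<xi> t *s a + \<eta> t *s b)) \<in> E"
proof -
  \<comment> \<open>Coordinate \<open>j\<close> of the argument of \<open>f\<close> is a linear
    combination of \<xi> and \<eta> with fixed coefficients \<open>a $ j\<close> and
    \<open>b $ j\<close>. The nested restrictions are the form in which the closure lemmas deliver
    it.\<close>
  have "(\<lambda>t\<in>I. (\<lambda>t\<in>I. a $ j * \<xi> t) t + (\<lambda>t\<in>I. b $ j * \<eta> t) t) \<in> E" for j
    using assms by (intro linear_subspace_add linear_subspace_scale)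
  then have "(\<lambda>t\<in>I. f (\<chi> j. (\<lambda>t\<in>I. (\<lambda>t\<in>I. a $ j * \<xi> t) t + (\<lambda>t\<in>I. b $ j * \<eta> t) t) t)) \<in> E"
    using assms(2) unfolding stable_wrt_def
    by (elim allE[of _ "\<lambda>j. \<lambda>t\<in>I. (\<lambda>t\<in>I. a $ j * \<xi> t) t + (\<lambda>t\<in>I. b $ j * \<eta> t) t"]) blast
  moreover have "\<xi> t *s a + \<eta> t *s b = (\<chi> j. a $ j * \<xi> t + b $ j * \<eta> t)" for t
    by (simp add: vec_eq_iff mult.commute)
  ultimately show ?thesis
    by (simp cong: restrict_cong)
qed

lemma E_closed_Un:
  fixes f :: "'k::field ^ 'n::finite \<Rightarrow> 'k"
  assumes E: "linear_subspace I E" and f: "stable_wrt I E f" "\<not> additively_affine f"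
    and S: "E_closed I E S" and T: "E_closed I E T"
  shows "E_closed I E (S \<union> T)"
  unfolding E_closed_def
proof (intro conjI ballI)
  show sub: "S \<union> T \<subseteq> I"
    using S T by (auto simp: E_closed_def)
  fix t assume t: "t \<in> I - (S \<union> T)"
  obtain \<xi> where \<xi>: "\<xi> \<in> E" "\<forall>s\<in>S. \<xi> s = 0" "\<xi> t = 1"
    using E_closed_separation[OF E S] t by blast
  obtain \<eta> where \<eta>: "\<eta> \<in> E" "\<forall>s\<in>T. \<eta> s = 0" "\<eta> t = 1"
    using E_closed_separation[OF E T] t by blast
  obtain a b where ab: "f (a + b) - f a - f b + f 0 \<noteq> 0"
    using not_additively_affine_imp_second_difference[OF f(2)] .
  \<comment> \<open>Putting 0 for \<open>a\<close> or \<open>b\<close> yields all four terms of the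
    second difference, so one membership fact covers them.\<close>
  define F where "F a b = (\<lambda>s\<in>I. f (\<xi> s *s a + \<eta> s *s b))" for a b
  define \<zeta> where "\<zeta> = (\<lambda>s\<in>I. (\<lambda>s\<in>I. (\<lambda>s\<in>I. F a b s - F a 0 s) s - F 0 b s) s + F 0 0 s)"
  have F: "F a b \<in> E" for a b
    unfolding F_def by (rule stable_wrt_combination[OF E f(1) \<xi>(1) \<eta>(1)])
  have "\<zeta> \<in> E"
    unfolding \<zeta>_def by (intro linear_subspace_add linear_subspace_diff E F)
  \<comment> \<open>Where \<xi> vanishes, \<open>F a b\<close> cancels against \<open>F 0 b\<close>
    and \<open>F a 0\<close> against \<open>F 0 0\<close>; where \<eta> vanishes, the pairs are
    \<open>F a b\<close>, \<open>F a 0\<close> and \<open>F 0 b\<close>,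
    \<open>F 0 0\<close>.\<close>
  moreover have "\<forall>s\<in>S \<union> T. \<zeta> s = 0"
    using sub \<xi>(2) \<eta>(2) by (auto simp: \<zeta>_def F_def)
  moreover have "\<zeta> t \<noteq> 0"
    using t ab \<xi>(3) \<eta>(3) by (simp add: \<zeta>_def F_def)
  ultimately show "\<exists>\<zeta>\<in>E. (\<forall>s\<in>S \<union> T. \<zeta> s = 0) \<and> \<zeta> t \<noteq> 0"
    by blast
qed

lemma E_closed_empty:
  assumes "contains_constants I E"
  shows "E_closed I E {}"
  unfolding E_closed_def
proof (intro conjI ballI)
  fix t assume "t \<in> I - {}"
  then show "\<exists>\<xi>\<in>E. (\<forall>s\<in>{}. \<xi> s = 0) \<and> \<xi> t \<noteq> 0"
    using assms by (intro bexI[of _ "\<lambda>t\<in>I. 1"]) (auto simp: contains_constants_def)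
qed simp

text \<open>A function separating \<open>t\<close> from one member of the family also vanishes on
  the smaller intersection. Intersecting with \<open>I\<close> makes the empty family give
  \<open>I\<close>.\<close>

lemma E_closed_Inter:
  assumes "\<And>S. S \<in> \<S> \<Longrightarrow> E_closed I E S"
  shows "E_closed I E (I \<inter> \<Inter>\<S>)"
  unfolding E_closed_def
proof (intro conjI ballI)
  fix t assume "t \<in> I - I \<inter> \<Inter>\<S>"
  then obtain S where S: "S \<in> \<S>" "t \<in> I - S"
    by blast
  then obtain \<xi> where "\<xi> \<in> E" "\<forall>s\<in>S. \<xi> s = 0" "\<xi> t \<noteq> 0"
    using assms[OF S(1)] unfolding E_closed_def by blast
  with S show "\<exists>\<xi>\<in>E. (\<forall>s\<in>I \<inter> \<Inter>\<S>. \<xi> s = 0) \<and> \<xi> t \<noteq> 0"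
    by blast
qed blast

lemma topology_inducing_imp_topology:
  assumes "topology_inducing I E"
  shows "\<exists>X. topspace X = I \<and> (\<forall>S. closedin X S \<longleftrightarrow> E_closed I E S)"
proof -
  define is_open where "is_open U \<longleftrightarrow> U \<subseteq> I \<and> E_closed I E (I - U)" for U
  have "istopology is_open"
    unfolding istopology_def
  proof (intro conjI allI impI)
    \<comment> \<open>Complements turn this intersection into a union of two closed sets, which is
      where the topology-inducing property enters.\<close>
    fix U V assume "is_open U" "is_open V"
    then show "is_open (U \<inter> V)"
      using assms by (auto simp: is_open_def topology_inducing_def Diff_Int)
  next
    fix \<U> assume "\<forall>U\<in>\<U>. is_open U"
    then have \<U>: "\<Union>\<U> \<subseteq> I" "\<And>U. U \<in> \<U> \<Longrightarrow> E_closed I E (I - U)"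
      by (auto simp: is_open_def)
    then have "E_closed I E (I \<inter> \<Inter>((-) I ` \<U>))"
      by (intro E_closed_Inter) blast
    moreover have "I - \<Union>\<U> = I \<inter> \<Inter>((-) I ` \<U>)"
      by blast
    ultimately show "is_open (\<Union>\<U>)"
      using \<U>(1) by (simp add: is_open_def)
  qed
  then have openin: "openin (topology is_open) = is_open"
    by (rule topology_inverse')
  \<comment> \<open>The complement of \<open>I\<close> is empty, and the constant 1 separates every
    point from the empty set.\<close>
  have "is_open I"
    using assms by (simp add: is_open_def topology_inducing_def E_closed_empty)
  then have topspace: "topspace (topology is_open) = I"
    unfolding topspace_def openin using is_open_def by blast
  have "closedin (topology is_open) S \<longleftrightarrow> E_closed I E S" for S
    unfolding closedin_def openin topspace
    by (auto simp: is_open_def E_closed_def double_diff)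
  with topspace show ?thesis
    by blast
qed

theorem theorem1:
  fixes I :: "'i set"
    and E :: "('i \<Rightarrow> 'k::field) set"
    and f :: "'k ^ 'n::finite \<Rightarrow> 'k"
  assumes "linear_subspace I E"
    and "contains_constants I E"
    and "stable_wrt I E f"
    and "\<not> additively_affine f"
  shows "topology_inducing I E \<and>
    (\<exists>X :: 'i topology. topspace X = I \<and> (\<forall>S. closedin X S \<longleftrightarrow> E_closed I E S))"
proof -
  have "topology_inducing I E"
    using assms E_closed_Un[OF assms(1,3,4)] by (simp add: topology_inducing_def)
  then show ?thesis
    using topology_inducing_imp_topology by blast
qed

end
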